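(* For any graphs $G$ and $H$, (i) $\rho_e^o(G\,\square\,H)\ge \max\{\rho_e^o(G)\,\alpha(H),\ \alpha(G)\,\rho_e^o(H)\}$, and (ii) $\rho_e^o(G\boxtimes H)\ge \max\{\rho_e^o(G)\,\alpha(H),\ \rho_e^o(H)\,\alpha(G)\}$. These bounds are sharp, that is, each of the bounds in (i) and (ii) is attained with equality by some graphs $G$ and $H$.
   Context: All graphs are finite and simple. A set $B\subseteq E(G)$ is an edge open packing set (EOP set) of $G$ if for any two distinct edges $e_1,e_2\in B$ there is no edge $e\in E(G)\setminus\{e_1,e_2\}$ joining an endvertex of $e_1$ to an endvertex of $e_2$ (that is, no edge $e$ such that $e_1,e,e_2$ form a path with middle edge $e$ or a triangle). Edges of $B$ may share an endvertex. The maximum cardinality of an EOP set is the EOP number $\rho_e^o(G)$. $\alpha(G)$ is the independence number of $G$. The following products of $G$ and $H$ have vertex set $V(G)\times V(H)$. In the Cartesian product $G\,\square\,H$ two vertices are adjacent if they are adjacent in one coordinate and equal in the other. In the direct product $G\times H$ two vertices are adjacent if they are adjacent in both coordinates. The edge set of the strong product $G\boxtimes H$ is $E(G\,\square\,H)\cup E(G\times H)$. *)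

theory Defs
  imports Main
begin

record 'a sgraph =
  verts :: "'a set"
  edges :: "'a set set"

definition simple_graph :: "'a sgraph \<Rightarrow> bool" where
  "simple_graph G \<longleftrightarrow>
     finite (verts G) \<and> (\<forall>e\<in>edges G. e \<subseteq> verts G \<and> card e = 2)"

definition adj :: "'a sgraph \<Rightarrow> 'a \<Rightarrow> 'a \<Rightarrow> bool" where
  "adj G u v \<longleftrightarrow> {u, v} \<in> edges G"

definition independent_set :: "'a sgraph \<Rightarrow> 'a set \<Rightarrow> bool" where
  "independent_set G S \<longleftrightarrow> S \<subseteq> verts G \<and> (\<forall>u\<in>S. \<forall>v\<in>S. \<not> adj G u v)"

definition independence_number :: "'a sgraph \<Rightarrow> nat" where
  "independence_number G = Max (card ` {S. independent_set G S})"

(* The case u = v is vacuous in a simple graph, since {u, u} is not an edge. *)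
definition eop_set :: "'a sgraph \<Rightarrow> 'a set set \<Rightarrow> bool" where
  "eop_set G B \<longleftrightarrow>
     B \<subseteq> edges G \<and>
     (\<forall>e1\<in>B. \<forall>e2\<in>B. e1 \<noteq> e2 \<longrightarrow>
        \<not> (\<exists>e\<in>edges G - {e1, e2}. \<exists>u\<in>e1. \<exists>v\<in>e2. e = {u, v}))"

definition eop_number :: "'a sgraph \<Rightarrow> nat" where
  "eop_number G = Max (card ` {B. eop_set G B})"

definition cartesian_product :: "'a sgraph \<Rightarrow> 'b sgraph \<Rightarrow> ('a \<times> 'b) sgraph" where
  "cartesian_product G H =
     \<lparr> verts = verts G \<times> verts H,
       edges = {{(g, h), (g', h')} | g h g' h'.
                  (g, h) \<in> verts G \<times> verts H \<and> (g', h') \<in> verts G \<times> verts H \<and>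
                  (adj G g g' \<and> h = h' \<or> g = g' \<and> adj H h h')} \<rparr>"

definition direct_product :: "'a sgraph \<Rightarrow> 'b sgraph \<Rightarrow> ('a \<times> 'b) sgraph" where
  "direct_product G H =
     \<lparr> verts = verts G \<times> verts H,
       edges = {{(g, h), (g', h')} | g h g' h'.
                  (g, h) \<in> verts G \<times> verts H \<and> (g', h') \<in> verts G \<times> verts H \<and>
                  adj G g g' \<and> adj H h h'} \<rparr>"

definition strong_product :: "'a sgraph \<Rightarrow> 'b sgraph \<Rightarrow> ('a \<times> 'b) sgraph" where
  "strong_product G H =
     \<lparr> verts = verts G \<times> verts H,
       edges = edges (cartesian_product G H) \<union> edges (direct_product G H) \<rparr>"

lemma simple_graph_adj_neq: "simple_graph G \<Longrightarrow> adj G u v \<Longrightarrow> u \<noteq> v"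
  by (auto simp: simple_graph_def adj_def)

lemma simple_graph_cartesian_product:
  assumes "simple_graph G" "simple_graph H"
  shows "simple_graph (cartesian_product G H)"
  unfolding simple_graph_def
proof (intro conjI ballI)
  show "finite (verts (cartesian_product G H))"
    using assms by (simp add: cartesian_product_def simple_graph_def)
next
  fix e assume "e \<in> edges (cartesian_product G H)"
  then show "e \<subseteq> verts (cartesian_product G H)" and "card e = 2"
    by (auto simp: cartesian_product_def card_insert_if
        dest: simple_graph_adj_neq[OF assms(1)] simple_graph_adj_neq[OF assms(2)])
qed

lemma simple_graph_direct_product:
  assumes "simple_graph G" "simple_graph H"
  shows "simple_graph (direct_product G H)"
  unfolding simple_graph_def
proof (intro conjI ballI)
  show "finite (verts (direct_product G H))"
    using assms by (simp add: direct_product_def simple_graph_def)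
next
  fix e assume "e \<in> edges (direct_product G H)"
  then show "e \<subseteq> verts (direct_product G H)" and "card e = 2"
    by (auto simp: direct_product_def card_insert_if
        dest: simple_graph_adj_neq[OF assms(1)] simple_graph_adj_neq[OF assms(2)])
qed

lemma simple_graph_strong_product:
  assumes "simple_graph G" "simple_graph H"
  shows "simple_graph (strong_product G H)"
proof -
  have "verts (strong_product G H) = verts (cartesian_product G H)"
    and "verts (strong_product G H) = verts (direct_product G H)"
    and "edges (strong_product G H) = edges (cartesian_product G H) \<union> edges (direct_product G H)"
    by (simp_all add: strong_product_def cartesian_product_def direct_product_def)
  then show ?thesis
    using simple_graph_cartesian_product[OF assms] simple_graph_direct_product[OF assms]
    unfolding simple_graph_def by (metis Un_iff)
qed

(* The sets of cardinalities whose maximum is taken are finite and nonempty. *)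
lemma finite_edges: "simple_graph G \<Longrightarrow> finite (edges G)"
  by (rule finite_subset[of _ "Pow (verts G)"]) (auto simp: simple_graph_def)

lemma finite_eop_sets: "simple_graph G \<Longrightarrow> finite {B. eop_set G B}"
  by (rule finite_subset[of _ "Pow (edges G)"]) (auto simp: eop_set_def finite_edges)

lemma eop_set_empty: "eop_set G {}"
  by (simp add: eop_set_def)

lemma finite_independent_sets: "simple_graph G \<Longrightarrow> finite {S. independent_set G S}"
  by (rule finite_subset[of _ "Pow (verts G)"]) (auto simp: independent_set_def simple_graph_def)

lemma independent_set_empty: "independent_set G {}"
  by (simp add: independent_set_def)

end

(* Lower bounds: copies of a maximum EOP set of one factor, placed in the layers over a maximum
   independent set of the other factor, form an EOP set, since no edge runs between two such layers.

   Sharpness: K2 with K2 for the strong product, which is complete.  For the Cartesian product take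
   P3 with P3.  The twelve edges of the 3 x 3 grid split into four triples of pairwise conflicting
   edges, so an EOP set has at most four of them, while P3 has EOP number and independence number
   at least two. *)
theory Submission
  imports Defs
begin

section \<open>EOP number and independence number as attained maxima\<close>

lemma eop_numberI:
  assumes "simple_graph G" "eop_set G B"
  shows "card B \<le> eop_number G"
  unfolding eop_number_def using assms by (intro Max_ge) (auto simp: finite_eop_sets)

lemma independence_numberI:
  assumes "simple_graph G" "independent_set G S"
  shows "card S \<le> independence_number G"
  unfolding independence_number_def using assms
  by (intro Max_ge) (auto simp: finite_independent_sets)

lemma eop_number_attained:
  assumes "simple_graph G"
  obtains B where "eop_set G B" "card B = eop_number G"
proof -
  have "eop_number G \<in> card ` {B. eop_set G B}"
    unfolding eop_number_def using assms eop_set_empty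
    by (intro Max_in) (auto simp: finite_eop_sets)
  then show thesis using that by auto
qed

lemma independence_number_attained:
  assumes "simple_graph G"
  obtains S where "independent_set G S" "card S = independence_number G"
proof -
  have "independence_number G \<in> card ` {S. independent_set G S}"
    unfolding independence_number_def using assms independent_set_empty
    by (intro Max_in) (auto simp: finite_independent_sets)
  then show thesis using that by auto
qed

lemma simple_graph_edgeE:
  assumes "simple_graph G" "e \<in> edges G"
  obtains u v where "e = {u, v}" "u \<in> verts G" "v \<in> verts G" "adj G u v"
proof -
  have "e \<subseteq> verts G" "card e = 2" using assms by (simp_all add: simple_graph_def)
  then obtain u v where "e = {u, v}" by (auto simp: card_2_iff)
  then show thesis using that[of u v] assms(2) \<open>e \<subseteq> verts G\<close> by (simp add: adj_def)
qed

lemma adj_verts: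
  assumes "simple_graph G" "adj G u v"
  shows "u \<in> verts G" "v \<in> verts G"
  using assms unfolding simple_graph_def adj_def by blast+

lemma adj_commute: "adj G u v \<longleftrightarrow> adj G v u"
  by (simp add: adj_def insert_commute)

section \<open>Lower bounds from copies of an EOP set in independent layers\<close>

text \<open>The map \<open>f\<close> may be \<open>Pair\<close> or its flipped version, which covers both factors of a product.\<close>

lemma eop_number_layers:
  assumes G: "simple_graph G" and H: "simple_graph H" and K: "simple_graph K"
    and inj: "\<And>g h g' h'. f g h = f g' h' \<Longrightarrow> g = g' \<and> h = h'"
    and layer: "\<And>g g' h. h \<in> verts H \<Longrightarrow> adj K (f g h) (f g' h) \<longleftrightarrow> adj G g g'"
    and between: "\<And>g g' h h'. h \<noteq> h' \<Longrightarrow> adj K (f g h) (f g' h') \<Longrightarrow> adj H h h'"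
  shows "eop_number G * independence_number H \<le> eop_number K"
proof -
  obtain B where B: "eop_set G B" "card B = eop_number G"
    using eop_number_attained[OF G] .
  obtain S where S: "independent_set H S" "card S = independence_number H"
    using independence_number_attained[OF H] .
  have SH: "S \<subseteq> verts H" and BG: "B \<subseteq> edges G"
    using S B by (auto simp: independent_set_def eop_set_def)
  \<comment> \<open>\<open>c (e, h)\<close> is the copy of the edge \<open>e\<close> in the layer
    over \<open>h\<close>.\<close>
  define c where "c = (\<lambda>(e, h). (\<lambda>g. f g h) ` e)"
  have nonempty: "e \<noteq> {}" if "e \<in> B" for e
    using that BG G by (force simp: simple_graph_def)
  \<comment> \<open>A copy determines its layer because edges are nonempty: any common point forces
    \<open>h = h'\<close>. Within one layer \<open>f\<close> is injective, so the original edges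
    agree as well.\<close>
  have "inj_on c (B \<times> S)"
  proof (rule inj_onI, clarify)
    fix d h d' h' assume *: "d \<in> B" "c (d, h) = c (d', h')"
    have eq: "(\<lambda>g. f g h) ` d = (\<lambda>g. f g h') ` d'" using *(2) by (simp add: c_def)
    obtain g where "g \<in> d" using nonempty[OF *(1)] by blast
    then obtain g' where "f g h = f g' h'" using eq by blast
    then have "h = h'" using inj by blast
    moreover have "inj (\<lambda>g. f g h')" using inj by (auto intro: injI)
    ultimately show "d = d' \<and> h = h'" using eq by (simp add: inj_image_eq_iff)
  qed
  then have card: "card (c ` (B \<times> S)) = eop_number G * independence_number H"
    using B S by (simp add: card_image card_cartesian_product)
  have "eop_set K (c ` (B \<times> S))"
    unfolding eop_set_def
  proof (intro conjI ballI impI notI subsetI)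
    fix x assume "x \<in> c ` (B \<times> S)"
    then obtain e h where eh: "e \<in> B" "h \<in> S" "x = (\<lambda>g. f g h) ` e" by (auto simp: c_def)
    obtain u v where "e = {u, v}" "adj G u v"
      using simple_graph_edgeE[OF G] eh BG by blast
    then show "x \<in> edges K"
      using layer[of h u v] eh SH by (auto simp: adj_def)
  next
    fix e1 e2 assume e: "e1 \<in> c ` (B \<times> S)" "e2 \<in> c ` (B \<times> S)" "e1 \<noteq> e2"
    assume "\<exists>e\<in>edges K - {e1, e2}. \<exists>x\<in>e1. \<exists>y\<in>e2. e = {x, y}"
    then obtain x y where xy: "x \<in> e1" "y \<in> e2" "{x, y} \<in> edges K" "{x, y} \<noteq> e1" "{x, y} \<noteq> e2"
      by blast
    obtain d1 h1 where 1: "d1 \<in> B" "h1 \<in> S" "e1 = (\<lambda>g. f g h1) ` d1" using e by (auto simp: c_def)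
    obtain d2 h2 where 2: "d2 \<in> B" "h2 \<in> S" "e2 = (\<lambda>g. f g h2) ` d2" using e by (auto simp: c_def)
    obtain u v where uv: "u \<in> d1" "v \<in> d2" "x = f u h1" "y = f v h2" using xy 1 2 by blast
    have adj: "adj K (f u h1) (f v h2)" using xy uv by (simp add: adj_def)
    \<comment> \<open>Otherwise \<open>between\<close> would produce an edge of \<open>H\<close>
      inside the independent set \<open>S\<close>. The conflict thus lives in a single layer and
      projects to a conflict in \<open>G\<close>.\<close>
    have "h1 = h2"
      using between[OF _ adj] S 1 2 by (auto simp: independent_set_def)
    then have "adj G u v" using layer[of h1 u v] adj 1 SH by auto
    moreover have "d1 \<noteq> d2" using e 1 2 \<open>h1 = h2\<close> by blast
    \<comment> \<open>If \<open>{u, v}\<close> were \<open>d1\<close> or \<open>d2\<close>, its copy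
      \<open>{x, y}\<close> would be \<open>e1\<close> or \<open>e2\<close>.\<close>
    moreover have "{u, v} \<noteq> d1" "{u, v} \<noteq> d2"
      using xy uv 1 2 \<open>h1 = h2\<close> by auto
    moreover have "\<not> (\<exists>e\<in>edges G - {d1, d2}. \<exists>u\<in>d1. \<exists>v\<in>d2. e = {u, v})"
      using B(1)[unfolded eop_set_def, THEN conjunct2, rule_format, of d1 d2] 1 2 \<open>d1 \<noteq> d2\<close>
      by blast
    ultimately show False using uv unfolding adj_def by blast
  qed
  then show ?thesis using eop_numberI[OF K] card by metis
qed

text \<open>An unordered edge may match the set comprehension in either order; symmetry of
  \<open>adj\<close> merges the two. Vertex membership survives only for the coordinate that stays
  fixed, as adjacency supplies it for the other.\<close>

lemma adj_cartesian_product: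
  assumes "simple_graph G" "simple_graph H"
  shows "adj (cartesian_product G H) (g, h) (g', h') \<longleftrightarrow>
    adj G g g' \<and> h = h' \<and> h \<in> verts H \<or> g = g' \<and> g \<in> verts G \<and> adj H h h'"
  unfolding adj_def[of "cartesian_product G H"]
  using adj_verts[OF assms(1), of g g'] adj_verts[OF assms(2), of h h']
    adj_commute[of G g g'] adj_commute[of H h h']
  by (fastforce simp: cartesian_product_def doubleton_eq_iff)

lemma adj_strong_product:
  assumes "simple_graph G" "simple_graph H"
  shows "adj (strong_product G H) (g, h) (g', h') \<longleftrightarrow>
    adj (cartesian_product G H) (g, h) (g', h') \<or> adj G g g' \<and> adj H h h'"
proof -
  have "adj (direct_product G H) (g, h) (g', h') \<longleftrightarrow> adj G g g' \<and> adj H h h'"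
    unfolding adj_def[of "direct_product G H"]
    using adj_verts[OF assms(1), of g g'] adj_verts[OF assms(2), of h h']
      adj_commute[of G g g'] adj_commute[of H h h']
    by (fastforce simp: direct_product_def doubleton_eq_iff)
  then show ?thesis by (simp add: adj_def strong_product_def)
qed

lemma eop_number_cartesian_product_ge:
  assumes G: "simple_graph G" and H: "simple_graph H"
  shows "max (eop_number G * independence_number H) (independence_number G * eop_number H)
    \<le> eop_number (cartesian_product G H)"
proof -
  note K = simple_graph_cartesian_product[OF G H]
  have "eop_number G * independence_number H \<le> eop_number (cartesian_product G H)"
    \<comment> \<open>Since \<open>H\<close> has no loops, an edge inside the layer over
      \<open>h\<close> can only come from an edge of \<open>G\<close>.\<close>
    by (rule eop_number_layers[where f = "\<lambda>g h. (g, h)", OF G H K])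
      (auto simp: adj_cartesian_product[OF G H] dest: simple_graph_adj_neq[OF H])
  moreover have "eop_number H * independence_number G \<le> eop_number (cartesian_product G H)"
    by (rule eop_number_layers[where f = "\<lambda>h g. (g, h)", OF H G K])
      (auto simp: adj_cartesian_product[OF G H] dest: simple_graph_adj_neq[OF G])
  ultimately show ?thesis by (simp add: mult.commute)
qed

text \<open>The additional diagonal edges also run only between layers over adjacent vertices, so
  the same layers work as in the Cartesian product.\<close>

lemma eop_number_strong_product_ge:
  assumes G: "simple_graph G" and H: "simple_graph H"
  shows "max (eop_number G * independence_number H) (eop_number H * independence_number G)
    \<le> eop_number (strong_product G H)"
proof -
  note K = simple_graph_strong_product[OF G H]
  have "eop_number G * independence_number H \<le> eop_number (strong_product G H)"
    by (rule eop_number_layers[where f = "\<lambda>g h. (g, h)", OF G H K])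
      (auto simp: adj_strong_product[OF G H] adj_cartesian_product[OF G H]
        dest: simple_graph_adj_neq[OF H])
  moreover have "eop_number H * independence_number G \<le> eop_number (strong_product G H)"
    by (rule eop_number_layers[where f = "\<lambda>h g. (g, h)", OF H G K])
      (auto simp: adj_strong_product[OF G H] adj_cartesian_product[OF G H]
        dest: simple_graph_adj_neq[OF G])
  ultimately show ?thesis by simp
qed

section \<open>Upper bounds from pairwise conflicting edges\<close>

text \<open>This is the configuration that \<open>eop_set\<close> forbids for two distinct edges;
  EOP sets are the independent sets of the resulting conflict graph on the edges.\<close>

definition edge_conflict :: "'a sgraph \<Rightarrow> 'a set \<Rightarrow> 'a set \<Rightarrow> bool" where
  "edge_conflict G e1 e2 \<longleftrightarrow> (\<exists>u\<in>e1. \<exists>v\<in>e2. adj G u v \<and> {u, v} \<noteq> e1 \<and> {u, v} \<noteq> e2)"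

text \<open>Symmetry lets each pair in a conflict class be checked in one order.\<close>

lemma symp_edge_conflict: "symp (edge_conflict G)"
proof (rule sympI)
  fix a b assume "edge_conflict G a b"
  then obtain u v where uv: "u \<in> a" "v \<in> b" "adj G u v" "{u, v} \<noteq> a" "{u, v} \<noteq> b"
    by (auto simp: edge_conflict_def)
  then have "adj G v u \<and> {v, u} \<noteq> b \<and> {v, u} \<noteq> a"
    by (simp add: adj_commute[of G v] insert_commute)
  then show "edge_conflict G b a"
    unfolding edge_conflict_def using uv(1,2) by (intro bexI)
qed

text \<open>Clique cover bound in the conflict graph: an EOP set meets each class of pairwise
  conflicting edges in at most one edge, and the classes together contain every edge.\<close>

lemma eop_number_le_conflict_cover:
  assumes G: "simple_graph G" and F: "finite F" and cover: "edges G \<subseteq> \<Union>F"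
    and conflict: "\<And>C. C \<in> F \<Longrightarrow> pairwise (edge_conflict G) C"
  shows "eop_number G \<le> card F"
proof -
  obtain B where B: "eop_set G B" "card B = eop_number G"
    using eop_number_attained[OF G] .
  have fin: "finite B"
    using B(1) finite_subset[OF _ finite_edges[OF G]] by (simp add: eop_set_def)
  have "card (B \<inter> C) \<le> 1" if "C \<in> F" for C
  proof -
    have "e1 = e2" if e: "e1 \<in> B \<inter> C" "e2 \<in> B \<inter> C" for e1 e2
    proof (rule ccontr)
      assume "e1 \<noteq> e2"
      then have "edge_conflict G e1 e2" using e conflict[OF \<open>C \<in> F\<close>] by (auto simp: pairwise_def)
      then obtain u v where "u \<in> e1" "v \<in> e2" "{u, v} \<in> edges G - {e1, e2}"
        unfolding edge_conflict_def adj_def by blast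
      moreover have "\<not> (\<exists>e\<in>edges G - {e1, e2}. \<exists>u\<in>e1. \<exists>v\<in>e2. e = {u, v})"
        using B(1)[unfolded eop_set_def, THEN conjunct2, rule_format, of e1 e2] e \<open>e1 \<noteq> e2\<close>
        by blast
      ultimately show False by blast
    qed
    then show ?thesis using fin by (simp add: card_le_Suc0_iff_eq)
  qed
  then have "(\<Sum>C\<in>F. card (B \<inter> C)) \<le> (\<Sum>C\<in>F. 1)" by (rule sum_mono)
  moreover have "card (\<Union>C\<in>F. B \<inter> C) \<le> (\<Sum>C\<in>F. card (B \<inter> C))" by (rule card_UN_le[OF F])
  moreover have "(\<Union>C\<in>F. B \<inter> C) = B" using B(1) cover by (auto simp: eop_set_def)
  ultimately show ?thesis using B(2) by simp
qed

text \<open>In a complete graph any two distinct edges conflict, so all edges form one conflict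
  class.\<close>

lemma eop_number_complete_le:
  assumes G: "simple_graph G"
    and complete: "\<And>u v. u \<in> verts G \<Longrightarrow> v \<in> verts G \<Longrightarrow> u \<noteq> v \<Longrightarrow> adj G u v"
  shows "eop_number G \<le> 1"
proof -
  have "edge_conflict G e1 e2" if e: "e1 \<in> edges G" "e2 \<in> edges G" "e1 \<noteq> e2" for e1 e2
  proof -
    have V: "e1 \<subseteq> verts G" "e2 \<subseteq> verts G" and c: "card e1 = 2" "card e2 = 2"
      using G e by (auto simp: simple_graph_def)
    have "finite e1" "finite e2" using c card.infinite by force+
    then have "\<not> e1 \<subseteq> e2" "\<not> e2 \<subseteq> e1" using c e card_subset_eq by metis+
    \<comment> \<open>An end of each edge outside the other: the edge \<open>{u, v}\<close> then
      differs from both \<open>e1\<close> and \<open>e2\<close>.\<close>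
    then obtain u v where "u \<in> e1" "u \<notin> e2" "v \<in> e2" "v \<notin> e1" by blast
    then show ?thesis using complete V unfolding edge_conflict_def by blast
  qed
  then have "eop_number G \<le> card {edges G}"
    by (intro eop_number_le_conflict_cover[OF G]) (auto simp: pairwise_def)
  then show ?thesis by simp
qed

section \<open>Sharpness for \<open>K2\<close> and \<open>P3\<close>\<close>

definition K2 :: "nat sgraph" where
  "K2 = \<lparr> verts = {0, 1}, edges = {{0, 1}} \<rparr>"

definition P3 :: "nat sgraph" where
  "P3 = \<lparr> verts = {0, 1, 2}, edges = {{0, 1}, {1, 2}} \<rparr>"

lemma simple_graph_K2: "simple_graph K2"
  by (simp add: simple_graph_def K2_def)

lemma simple_graph_P3: "simple_graph P3"
  by (simp add: simple_graph_def P3_def)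

lemma verts_P3: "verts P3 = {0, 1, 2}"
  by (simp add: P3_def)

lemma adj_P3: "adj P3 u v \<longleftrightarrow> u = 0 \<and> v = 1 \<or> u = 1 \<and> v = 0 \<or> u = 1 \<and> v = 2 \<or> u = 2 \<and> v = 1"
  by (auto simp: adj_def P3_def doubleton_eq_iff)

lemma eop_number_strong_K2_K2:
  "eop_number (strong_product K2 K2)
    = max (eop_number K2 * independence_number K2) (eop_number K2 * independence_number K2)"
proof (rule antisym)
  have "card {{0, 1 :: nat}} \<le> eop_number K2"
    by (rule eop_numberI[OF simple_graph_K2]) (simp add: eop_set_def K2_def)
  moreover have "card {0 :: nat} \<le> independence_number K2"
    by (rule independence_numberI[OF simple_graph_K2]) (simp add: independent_set_def adj_def K2_def)
  \<comment> \<open>This product is the complete graph on four vertices. Since both numbers of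
    \<open>K2\<close> are at least 1, the right-hand side is at least 1.\<close>
  moreover have "eop_number (strong_product K2 K2) \<le> 1"
  proof (rule eop_number_complete_le[OF simple_graph_strong_product[OF simple_graph_K2 simple_graph_K2]])
    fix u v assume "u \<in> verts (strong_product K2 K2)" "v \<in> verts (strong_product K2 K2)" "u \<noteq> v"
    then show "adj (strong_product K2 K2) u v"
      by (cases u; cases v)
        (auto simp: adj_strong_product adj_cartesian_product simple_graph_K2,
         auto simp: strong_product_def K2_def adj_def insert_commute)
  qed
  ultimately show "eop_number (strong_product K2 K2)
    \<le> max (eop_number K2 * independence_number K2) (eop_number K2 * independence_number K2)"
    using mult_le_mono[of 1 "eop_number K2" 1 "independence_number K2"]
    by (simp add: le_trans)
qed (rule eop_number_strong_product_ge[OF simple_graph_K2 simple_graph_K2])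

lemma eop_number_grid_le: "eop_number (cartesian_product P3 P3) \<le> 4"
proof -
  let ?P = "cartesian_product P3 P3"
  note adj = adj_cartesian_product[OF simple_graph_P3 simple_graph_P3] adj_P3 verts_P3
  \<comment> \<open>one edge at the centre (1, 1) and two of the boundary cycle in each triple\<close>
  define T :: "nat \<Rightarrow> (nat \<times> nat) set set" where
    "T i = [{{(1,1),(1,0)}, {(1,2),(0,2)}, {(0,1),(0,0)}},
            {{(1,1),(2,1)}, {(0,2),(0,1)}, {(0,0),(1,0)}},
            {{(1,1),(1,2)}, {(1,0),(2,0)}, {(2,1),(2,2)}},
            {{(1,1),(0,1)}, {(2,0),(2,1)}, {(2,2),(1,2)}}] ! i" for i
  have pw: "pairwise R {a, b, c}" if "R a b" "R a c" "R b c" "symp R"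
    for R :: "(nat \<times> nat) set \<Rightarrow> (nat \<times> nat) set \<Rightarrow> bool" and a b c
    using that(1-3) that(1-3)[THEN sympD[OF that(4)]] by (auto simp: pairwise_insert)
  \<comment> \<open>Three pairs per triple are checked, each joined by a grid edge outside the pair;
    for instance \<open>{(1,1),(1,2)}\<close> joins the first two edges of
    \<open>T 0\<close>.\<close>
  have conflict: "pairwise (edge_conflict ?P) (T i)" if "i \<in> {0, 1, 2, 3}" for i
    using that
    by (elim insertE emptyE; simp add: T_def; intro pw symp_edge_conflict;
        simp add: edge_conflict_def adj doubleton_eq_iff)
  have "edges ?P \<subseteq> \<Union>(T ` {0, 1, 2, 3})"
  proof
    fix e assume "e \<in> edges ?P"
    then obtain x y where "e = {x, y}" "adj ?P x y"
      using simple_graph_edgeE[OF simple_graph_cartesian_product[OF simple_graph_P3 simple_graph_P3]]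
      by blast
    then obtain g h g' h' where e: "e = {(g, h), (g', h')}" "adj ?P (g, h) (g', h')"
      by (cases x; cases y) auto
    show "e \<in> \<Union>(T ` {0, 1, 2, 3})"
      \<comment> \<open>The adjacency formula splits into 24 cases: each of the twelve grid edges in
        both orders.\<close>
      using e(2) unfolding e(1) adj T_def
      by (elim disjE conjE insertE emptyE; simp add: doubleton_eq_iff)
  qed
  then have "eop_number ?P \<le> card (T ` {0, 1, 2, 3})"
    using conflict
    by (intro eop_number_le_conflict_cover simple_graph_cartesian_product simple_graph_P3) auto
  also have "\<dots> \<le> card {0, 1, 2, 3 :: nat}" by (rule card_image_le) simp
  finally show ?thesis by simp
qed

lemma eop_number_cartesian_P3_P3:
  "eop_number (cartesian_product P3 P3)
    = max (eop_number P3 * independence_number P3) (independence_number P3 * eop_number P3)"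
proof (rule antisym)
  \<comment> \<open>Both edges of \<open>P3\<close> together form an EOP set, as there is no third
    edge to join them; the two ends of the path are independent. Hence the right-hand side is at
    least 4.\<close>
  have "card {{0, 1}, {1, 2 :: nat}} \<le> eop_number P3"
    by (rule eop_numberI[OF simple_graph_P3]) (auto simp: eop_set_def P3_def doubleton_eq_iff)
  moreover have "card {0, 2 :: nat} \<le> independence_number P3"
    by (rule independence_numberI[OF simple_graph_P3]) (simp add: independent_set_def adj_P3 verts_P3)
  ultimately have "2 * 2 \<le> eop_number P3 * independence_number P3"
    by (intro mult_le_mono) (simp_all add: doubleton_eq_iff)
  then show "eop_number (cartesian_product P3 P3)
    \<le> max (eop_number P3 * independence_number P3) (independence_number P3 * eop_number P3)"
    using eop_number_grid_le by simp
qed (rule eop_number_cartesian_product_ge[OF simple_graph_P3 simple_graph_P3])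

text \<open>The sharpness witnesses must have edges, because two edgeless factors give the trivial
  equality 0 = 0.\<close>

theorem corollary5p3:
  "(\<forall>(G :: 'a sgraph) (H :: 'b sgraph). simple_graph G \<longrightarrow> simple_graph H \<longrightarrow>
      eop_number (cartesian_product G H)
        \<ge> max (eop_number G * independence_number H) (independence_number G * eop_number H)
    \<and> eop_number (strong_product G H)
        \<ge> max (eop_number G * independence_number H) (eop_number H * independence_number G))
  \<and> (\<exists>(G :: nat sgraph) (H :: nat sgraph). simple_graph G \<and> simple_graph H \<and>
      edges G \<noteq> {} \<and> edges H \<noteq> {} \<and>
      eop_number (cartesian_product G H)
        = max (eop_number G * independence_number H) (independence_number G * eop_number H))
  \<and> (\<exists>(G :: nat sgraph) (H :: nat sgraph). simple_graph G \<and> simple_graph H \<and>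
      edges G \<noteq> {} \<and> edges H \<noteq> {} \<and>
      eop_number (strong_product G H)
        = max (eop_number G * independence_number H) (eop_number H * independence_number G))"
proof (intro conjI allI impI)
  show "\<exists>(G :: nat sgraph) (H :: nat sgraph). simple_graph G \<and> simple_graph H \<and>
      edges G \<noteq> {} \<and> edges H \<noteq> {} \<and>
      eop_number (cartesian_product G H)
        = max (eop_number G * independence_number H) (independence_number G * eop_number H)"
    using simple_graph_P3 eop_number_cartesian_P3_P3
    by (intro exI[of _ P3]) (simp add: P3_def)
  show "\<exists>(G :: nat sgraph) (H :: nat sgraph). simple_graph G \<and> simple_graph H \<and>
      edges G \<noteq> {} \<and> edges H \<noteq> {} \<and>
      eop_number (strong_product G H)
        = max (eop_number G * independence_number H) (eop_number H * independence_number G)"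
    using simple_graph_K2 eop_number_strong_K2_K2
    by (intro exI[of _ K2]) (simp add: K2_def)
qed (simp_all only: eop_number_cartesian_product_ge eop_number_strong_product_ge)

end
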